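(* There is a bijective correspondence between the class of cancellative semigroups $S$ with identity $1_S$ satisfying (C1) and such that the quotient map from $S$ onto $\mathcal S$ admits a transversal homomorphism which embeds $\mathcal S$ into $S$, and the class of semidirect product semigroups $G\rtimes_\theta P$ arising from a cancellative semigroup $P$ with $P^*=\{1_P\}$, which acts by injective endomorphisms of a group $G$.
   Context: A semigroup is cancellative if it is both left and right cancellative. For a semigroup $S$ with identity $1_S$, $S^*$ denotes its group of invertible elements. Condition (C1): $aS^*\subseteq S^*a$ for all $a\in S$. For $a,b\in S$ write $a\sim b$ if $a=xb$ for some $x\in S^*$; under (C1) this is a congruence on $S$, and $\mathcal S:=S/{\sim}$ is the quotient semigroup of equivalence classes $[a]$, with product $[a][b]=[ab]$ and identity $[1_S]$. The quotient map is $S\to\mathcal S$, $a\mapsto[a]$; a transversal homomorphism for it is a semigroup homomorphism $\mathcal S\to S$ which is a right inverse of the quotient map. An action $\theta$ of a semigroup $P$ with identity $1_P$ on a group $G$ is a map $p\mapsto\theta_p$ from $P$ into the endomorphisms of $G$ with $\theta_p\theta_q=\theta_{pq}$ for all $p,q\in P$ and $\theta_{1_P}=\mathrm{id}_G$. The semidirect product $G\rtimes_\theta P$ is the set $G\times P$ with multiplication $(g,p)(h,q)=(g\theta_p(h),pq)$. *)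

theory Defs
  imports "HOL-Algebra.Divisibility" "HOL-Algebra.Coset"
begin

text \<open>
  Semigroups with identity are monoid records satisfying \<^locale>\<open>monoid\<close>, cancellative ones satisfy
  \<^locale>\<open>monoid_cancel\<close>; \<^const>\<open>Units\<close> is the set of (two-sided) invertible elements and
  \<^const>\<open>units_of\<close> is the group they form.
\<close>

definition cond_C1 :: "('a, 'b) monoid_scheme \<Rightarrow> bool" where
  "cond_C1 S \<longleftrightarrow> (\<forall>a\<in>carrier S. a <#\<^bsub>S\<^esub> Units S \<subseteq> Units S #>\<^bsub>S\<^esub> a)"

definition unit_rel :: "('a, 'b) monoid_scheme \<Rightarrow> ('a \<times> 'a) set" where
  "unit_rel S = {(a, b). a \<in> carrier S \<and> b \<in> carrier S \<and> (\<exists>x\<in>Units S. a = x \<otimes>\<^bsub>S\<^esub> b)}"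

definition unit_class :: "('a, 'b) monoid_scheme \<Rightarrow> 'a \<Rightarrow> 'a set" where
  "unit_class S a = unit_rel S `` {a}"

text \<open>
  The product of two classes is written as a union over representatives; under (C1) all members of
  this union coincide (see \<open>quotient_mult_class\<close> below), so that the product of the classes
  of a and b is the class of the product of a and b.
\<close>

definition quotient_semigroup :: "('a, 'b) monoid_scheme \<Rightarrow> 'a set monoid" where
  "quotient_semigroup S =
    \<lparr>carrier = carrier S // unit_rel S,
     mult = (\<lambda>X Y. \<Union>a\<in>X. \<Union>b\<in>Y. unit_class S (a \<otimes>\<^bsub>S\<^esub> b)),
     one = unit_class S \<one>\<^bsub>S\<^esub>\<rparr>"

definition transversal_hom :: "('a, 'b) monoid_scheme \<Rightarrow> ('a set \<Rightarrow> 'a) \<Rightarrow> bool" where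
  "transversal_hom S \<phi> \<longleftrightarrow>
    \<phi> \<in> hom (quotient_semigroup S) S \<and>
    (\<forall>X\<in>carrier (quotient_semigroup S). unit_class S (\<phi> X) = X)"

definition split_semigroups :: "'a monoid set" where
  "split_semigroups =
    {S. monoid_cancel S \<and> cond_C1 S \<and>
        (\<exists>\<phi>. transversal_hom S \<phi> \<and> inj_on \<phi> (carrier (quotient_semigroup S)))}"

definition acts_by_endos ::
  "('p, 'c) monoid_scheme \<Rightarrow> ('g, 'd) monoid_scheme \<Rightarrow> ('p \<Rightarrow> 'g \<Rightarrow> 'g) \<Rightarrow> bool" where
  "acts_by_endos P G \<theta> \<longleftrightarrow>
    (\<forall>p\<in>carrier P. \<theta> p \<in> hom G G) \<and>
    (\<forall>p\<in>carrier P. \<forall>q\<in>carrier P. \<forall>g\<in>carrier G. \<theta> p (\<theta> q g) = \<theta> (p \<otimes>\<^bsub>P\<^esub> q) g) \<and>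
    (\<forall>g\<in>carrier G. \<theta> \<one>\<^bsub>P\<^esub> g = g)"

definition semidirect ::
  "('g, 'c) monoid_scheme \<Rightarrow> ('p, 'd) monoid_scheme \<Rightarrow> ('p \<Rightarrow> 'g \<Rightarrow> 'g) \<Rightarrow> ('g \<times> 'p) monoid" where
  "semidirect G P \<theta> =
    \<lparr>carrier = carrier G \<times> carrier P,
     mult = (\<lambda>(g, p) (h, q). (g \<otimes>\<^bsub>G\<^esub> \<theta> p h, p \<otimes>\<^bsub>P\<^esub> q)),
     one = (\<one>\<^bsub>G\<^esub>, \<one>\<^bsub>P\<^esub>)\<rparr>"

definition injective_system ::
  "('g, 'c) monoid_scheme \<Rightarrow> ('p, 'd) monoid_scheme \<Rightarrow> ('p \<Rightarrow> 'g \<Rightarrow> 'g) \<Rightarrow> bool" where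
  "injective_system G P \<theta> \<longleftrightarrow>
    group G \<and> monoid_cancel P \<and> Units P = {\<one>\<^bsub>P\<^esub>} \<and>
    acts_by_endos P G \<theta> \<and> (\<forall>p\<in>carrier P. inj_on (\<theta> p) (carrier G))"

definition semidirect_products :: "('g \<times> 'p) monoid set" where
  "semidirect_products =
    {semidirect G P \<theta> | (G :: 'g monoid) (P :: 'p monoid) \<theta>. injective_system G P \<theta>}"

text \<open>
  A transversal homomorphism \<open>\<phi>\<close> makes the quotient act on the group of units by
  \<open>\<phi> X g = \<theta>\<^sub>X(g) \<phi> X\<close>: the unit \<open>\<theta>\<^sub>X(g)\<close> exists by (C1) and is unique by
  right cancellation.
\<close>

definition conj_action ::
  "('a, 'b) monoid_scheme \<Rightarrow> ('a set \<Rightarrow> 'a) \<Rightarrow> 'a set \<Rightarrow> 'a \<Rightarrow> 'a" where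
  "conj_action S \<phi> X g = (THE h. h \<in> Units S \<and> \<phi> X \<otimes>\<^bsub>S\<^esub> g = h \<otimes>\<^bsub>S\<^esub> \<phi> X)"

definition associated_semidirect ::
  "('a, 'b) monoid_scheme \<Rightarrow> ('a set \<Rightarrow> 'a) \<Rightarrow> ('a \<times> 'a set) monoid" where
  "associated_semidirect S \<phi> =
    semidirect (units_of S) (quotient_semigroup S) (conj_action S \<phi>)"

text \<open>
  Isomorphism of semigroups within a class \<open>C\<close>, and the map induced on isomorphism classes by
  \<open>S \<mapsto> associated_semidirect S \<phi>\<close>.  An isomorphism class of members of
  \<^const>\<open>split_semigroups\<close> over the type \<open>'u\<close> is sent to the set of all members of
  \<^const>\<open>semidirect_products\<close> (with group and semigroup carried by \<open>'u\<close>) isomorphic to an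
  associated semidirect product; these sets are again isomorphism classes only when \<open>'u\<close> is
  large enough, e.g. infinite.
\<close>

definition iso_within :: "'a monoid set \<Rightarrow> ('a monoid \<times> 'a monoid) set" where
  "iso_within C = {(S, T). S \<in> C \<and> T \<in> C \<and> S \<cong> T}"

definition associated_class :: "'u monoid set \<Rightarrow> ('u \<times> 'u) monoid set" where
  "associated_class X =
    {T \<in> semidirect_products.
      \<exists>S\<in>X. \<exists>\<phi>. transversal_hom S \<phi> \<and> associated_semidirect S \<phi> \<cong> T}"

lemma equiv_unit_rel:
  assumes "monoid S"
  shows "equiv (carrier S) (unit_rel S)"
proof -
  interpret monoid S by fact
  show ?thesis
  proof (rule equivI)
    show "unit_rel S \<subseteq> carrier S \<times> carrier S"
      by (auto simp: unit_rel_def)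
    show "refl_on (carrier S) (unit_rel S)"
      by (rule refl_onI) (auto simp: unit_rel_def intro!: bexI[of _ "\<one>\<^bsub>S\<^esub>"])
    show "sym (unit_rel S)"
    proof (rule symI)
      fix a b assume "(a, b) \<in> unit_rel S"
      then obtain x where x: "a \<in> carrier S" "b \<in> carrier S" "x \<in> Units S" "a = x \<otimes>\<^bsub>S\<^esub> b"
        by (auto simp: unit_rel_def)
      have "inv\<^bsub>S\<^esub> x \<otimes>\<^bsub>S\<^esub> a = b"
        unfolding x(4) using x(2,3) by (simp add: m_assoc[symmetric] Units_closed)
      moreover have "inv\<^bsub>S\<^esub> x \<in> Units S"
        using x(3) by simp
      ultimately show "(b, a) \<in> unit_rel S"
        unfolding unit_rel_def using x(1,2) by blast
    qed
    show "trans (unit_rel S)"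
    proof (rule transI)
      fix a b c assume "(a, b) \<in> unit_rel S" "(b, c) \<in> unit_rel S"
      then obtain x y where x: "a \<in> carrier S" "b \<in> carrier S" "c \<in> carrier S"
        "x \<in> Units S" "y \<in> Units S" "a = x \<otimes>\<^bsub>S\<^esub> b" "b = y \<otimes>\<^bsub>S\<^esub> c"
        by (auto simp: unit_rel_def)
      then have "a = (x \<otimes>\<^bsub>S\<^esub> y) \<otimes>\<^bsub>S\<^esub> c"
        by (simp add: m_assoc Units_closed)
      moreover have "x \<otimes>\<^bsub>S\<^esub> y \<in> Units S"
        using x(4,5) by simp
      ultimately show "(a, c) \<in> unit_rel S"
        unfolding unit_rel_def using x(1,3) by blast
    qed
  qed
qed

lemma unit_rel_mult:
  assumes "monoid S" "cond_C1 S" "(a, a') \<in> unit_rel S" "(b, b') \<in> unit_rel S"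
  shows "(a \<otimes>\<^bsub>S\<^esub> b, a' \<otimes>\<^bsub>S\<^esub> b') \<in> unit_rel S"
proof -
  interpret monoid S by fact
  obtain x y where x: "a' \<in> carrier S" "b' \<in> carrier S" "x \<in> Units S" "y \<in> Units S"
    "a = x \<otimes>\<^bsub>S\<^esub> a'" "b = y \<otimes>\<^bsub>S\<^esub> b'"
    using assms(3,4) by (auto simp: unit_rel_def)
  have "a' \<otimes>\<^bsub>S\<^esub> y \<in> a' <#\<^bsub>S\<^esub> Units S"
    using x by (auto simp: l_coset_def)
  then have "a' \<otimes>\<^bsub>S\<^esub> y \<in> Units S #>\<^bsub>S\<^esub> a'"
    using assms(2) x by (auto simp: cond_C1_def)
  then obtain z where z: "z \<in> Units S" "a' \<otimes>\<^bsub>S\<^esub> y = z \<otimes>\<^bsub>S\<^esub> a'"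
    by (auto simp: r_coset_def)
  have "a \<otimes>\<^bsub>S\<^esub> b = x \<otimes>\<^bsub>S\<^esub> ((a' \<otimes>\<^bsub>S\<^esub> y) \<otimes>\<^bsub>S\<^esub> b')"
    using x by (simp add: m_assoc Units_closed)
  also have "\<dots> = (x \<otimes>\<^bsub>S\<^esub> z) \<otimes>\<^bsub>S\<^esub> (a' \<otimes>\<^bsub>S\<^esub> b')"
    using x z by (simp add: m_assoc Units_closed)
  finally show ?thesis
    using x z by (auto simp: unit_rel_def Units_closed)
qed

lemma quotient_mult_class:
  assumes "monoid S" "cond_C1 S" "a \<in> carrier S" "b \<in> carrier S"
  shows "unit_class S a \<otimes>\<^bsub>quotient_semigroup S\<^esub> unit_class S b = unit_class S (a \<otimes>\<^bsub>S\<^esub> b)"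
proof -
  have eq: "equiv (carrier S) (unit_rel S)"
    by (rule equiv_unit_rel) fact
  have rep: "unit_class S (a' \<otimes>\<^bsub>S\<^esub> b') = unit_class S (a \<otimes>\<^bsub>S\<^esub> b)"
    if "a' \<in> unit_class S a" "b' \<in> unit_class S b" for a' b'
    unfolding unit_class_def
    using that unit_rel_mult[OF assms(1,2), of a a' b b'] equiv_class_eq[OF eq]
    by (auto simp: unit_class_def)
  have self: "a \<in> unit_class S a" "b \<in> unit_class S b"
    using equiv_class_self[OF eq] assms by (auto simp: unit_class_def)
  have "(\<Union>a'\<in>unit_class S a. \<Union>b'\<in>unit_class S b. unit_class S (a' \<otimes>\<^bsub>S\<^esub> b'))
      = (\<Union>a'\<in>unit_class S a. \<Union>b'\<in>unit_class S b. unit_class S (a \<otimes>\<^bsub>S\<^esub> b))"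
    by (intro SUP_cong refl rep)
  also have "\<dots> = unit_class S (a \<otimes>\<^bsub>S\<^esub> b)"
    using self by blast
  finally show ?thesis
    unfolding quotient_semigroup_def by (simp only: monoid.simps)
qed

end

theory Submission
  imports Defs
begin

text \<open>
  Given a transversal homomorphism \<open>\<phi>\<close>, every element of \<open>S\<close> factors uniquely as
  \<open>g \<phi>(X)\<close> with \<open>g\<close> a unit, and moving units to the left past \<open>\<phi>(X)\<close> by (C1) is exactly the
  twisting in the semidirect product.  Conversely the units of \<open>G \<rtimes> P\<close> are the pairs \<open>(g, 1)\<close>,
  because \<open>P\<close> has no other invertible element, so the classes are the fibres \<open>G \<times> {p}\<close> and
  \<open>p \<mapsto> (1, p)\<close> is a transversal homomorphism.  On isomorphism classes the correspondence is
  just "isomorphic to"; \<open>\<S>\<close> is carried by subsets of \<open>S\<close>, but its image under \<open>\<phi>\<close> is a copy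
  inside \<open>S\<close>, and over an infinite type a semidirect product on pairs can be recoded on the type
  itself.
\<close>

section \<open>Isomorphisms of monoids\<close>

lemma monoid_iso_set_sym:
  assumes "monoid G" "h \<in> iso G H"
  shows "inv_into (carrier G) h \<in> iso H G"
proof -
  interpret monoid G by fact
  let ?k = "inv_into (carrier G) h"
  have h: "h \<in> hom G H" "bij_betw h (carrier G) (carrier H)"
    using assms(2) by (auto simp: iso_def)
  have k: "bij_betw ?k (carrier H) (carrier G)"
    by (rule bij_betw_inv_into) (rule h)
  show ?thesis
  proof (rule isoI[OF homI k])
    fix x y assume "x \<in> carrier H" "y \<in> carrier H"
    then obtain a b where ab: "a \<in> carrier G" "b \<in> carrier G" "x = h a" "y = h b"
      using h(2) by (metis bij_betw_imp_surj_on imageE)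
    then have "x \<otimes>\<^bsub>H\<^esub> y = h (a \<otimes>\<^bsub>G\<^esub> b)"
      using hom_mult[OF h(1)] by simp
    then show "?k (x \<otimes>\<^bsub>H\<^esub> y) = ?k x \<otimes>\<^bsub>G\<^esub> ?k y"
      using ab h(2) by (simp add: bij_betw_def inv_into_f_f)
  qed (use k in \<open>auto simp: bij_betw_def\<close>)
qed

lemma monoid_iso_sym: "monoid G \<Longrightarrow> G \<cong> H \<Longrightarrow> H \<cong> G"
  unfolding is_iso_def using monoid_iso_set_sym by blast

text \<open>Membership in \<open>hom\<close> says nothing about identities. Surjectivity supplies
  \<open>e\<close> mapped to the identity of \<open>H\<close>, and
  \<open>h \<one> \<otimes> h e\<close> is both \<open>h \<one>\<close> and, by multiplicativity,
  \<open>h e\<close>.\<close>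

lemma monoid_iso_one:
  assumes "monoid G" "monoid H" "h \<in> iso G H"
  shows "h \<one>\<^bsub>G\<^esub> = \<one>\<^bsub>H\<^esub>"
proof -
  interpret G: monoid G by fact
  interpret H: monoid H by fact
  obtain e where e: "e \<in> carrier G" "h e = \<one>\<^bsub>H\<^esub>"
    using assms(3) H.one_closed unfolding iso_iff by (metis imageE)
  have "h \<one>\<^bsub>G\<^esub> = h \<one>\<^bsub>G\<^esub> \<otimes>\<^bsub>H\<^esub> h e"
    using assms(3) e by (auto simp: iso_iff hom_in_carrier)
  also have "\<dots> = h (\<one>\<^bsub>G\<^esub> \<otimes>\<^bsub>G\<^esub> e)"
    using assms(3) e by (subst hom_mult[of h G H]) (auto simp: iso_iff)
  finally show ?thesis
    using e by simp
qed

lemma monoid_iso_Units: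
  assumes "monoid G" "monoid H" "h \<in> iso G H" "x \<in> Units G"
  shows "h x \<in> Units H"
proof -
  have h: "h \<in> hom G H"
    using assms(3) by (simp add: iso_iff)
  obtain y where y: "x \<in> carrier G" "y \<in> carrier G"
    "y \<otimes>\<^bsub>G\<^esub> x = \<one>\<^bsub>G\<^esub>" "x \<otimes>\<^bsub>G\<^esub> y = \<one>\<^bsub>G\<^esub>"
    using assms(4) by (auto simp: Units_def)
  have "h y \<otimes>\<^bsub>H\<^esub> h x = \<one>\<^bsub>H\<^esub>" "h x \<otimes>\<^bsub>H\<^esub> h y = \<one>\<^bsub>H\<^esub>"
    using y hom_mult[OF h, symmetric] monoid_iso_one[OF assms(1-3)] by auto
  then show ?thesis
    using y h by (auto simp: Units_def hom_in_carrier)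
qed

text \<open>Apply \<open>h\<close>, cancel in \<open>H\<close>, and return by injectivity. This
  serves the quotient, which a transversal homomorphism embeds in \<open>S\<close>, as well as
  isomorphic copies.\<close>

lemma monoid_cancel_inj_hom:
  assumes "monoid G" "monoid_cancel H" "h \<in> hom G H" "inj_on h (carrier G)"
  shows "monoid_cancel G"
proof -
  interpret G: monoid G by fact
  interpret H: monoid_cancel H by fact
  show ?thesis
  proof (rule G.monoid_cancelI)
    fix a b c assume c: "a \<in> carrier G" "b \<in> carrier G" "c \<in> carrier G"
    {
      assume "c \<otimes>\<^bsub>G\<^esub> a = c \<otimes>\<^bsub>G\<^esub> b"
      then have "h c \<otimes>\<^bsub>H\<^esub> h a = h c \<otimes>\<^bsub>H\<^esub> h b"
        using c hom_mult[OF assms(3)] by metis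
      then show "a = b"
        using c assms(3,4) H.l_cancel by (metis hom_in_carrier inj_onD)
    next
      assume "a \<otimes>\<^bsub>G\<^esub> c = b \<otimes>\<^bsub>G\<^esub> c"
      then have "h a \<otimes>\<^bsub>H\<^esub> h c = h b \<otimes>\<^bsub>H\<^esub> h c"
        using c hom_mult[OF assms(3)] by metis
      then show "a = b"
        using c assms(3,4) H.r_cancel by (metis hom_in_carrier inj_onD)
    }
  qed
qed

lemma monoid_cancel_iso:
  assumes "monoid_cancel G" "monoid H" "h \<in> iso G H"
  shows "monoid_cancel H"
  using monoid_cancel_inj_hom[OF assms(2,1)] monoid_iso_set_sym[OF _ assms(3)] assms(1)
  by (auto simp: iso_iff monoid_cancel_def)

text \<open>The multiplication is transported along \<open>e\<close>. Later this moves a semidirect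
  product from a type of pairs to the type of its components.\<close>

lemma ex_monoid_copy:
  fixes D :: "'b monoid" and e :: "'b \<Rightarrow> 'c"
  assumes "monoid D" "inj_on e (carrier D)"
  shows "\<exists>S :: 'c monoid. monoid S \<and> D \<cong> S"
proof -
  interpret monoid D by fact
  let ?d = "inv_into (carrier D) e"
  define H where "H = \<lparr>carrier = e ` carrier D, mult = (\<lambda>x y. e (?d x \<otimes>\<^bsub>D\<^esub> ?d y)), one = e \<one>\<^bsub>D\<^esub>\<rparr>"
  have iso: "e \<in> iso D H"
    unfolding iso_def hom_def H_def using assms(2) by (auto simp: bij_betw_def inv_into_f_f)
  \<comment> \<open>The updates change nothing, since \<open>H\<close> already has this carrier and
    identity; they only match the form in which the image of a monoid under a homomorphism is a
    monoid.\<close>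
  then have "monoid (H\<lparr>carrier := e ` carrier D, one := e \<one>\<^bsub>D\<^esub>\<rparr>)"
    by (intro hom_imp_img_monoid) (simp add: iso_iff)
  then have "monoid H"
    by (simp add: H_def)
  then show ?thesis
    using iso is_isoI by blast
qed

section \<open>The quotient and its transversal homomorphisms\<close>

lemma unit_class_self: "monoid S \<Longrightarrow> a \<in> carrier S \<Longrightarrow> a \<in> unit_class S a"
  unfolding unit_class_def by (rule equiv_class_self[OF equiv_unit_rel])

lemma unit_class_eq_iff:
  assumes "monoid S" "a \<in> carrier S" "b \<in> carrier S"
  shows "unit_class S a = unit_class S b \<longleftrightarrow> (\<exists>x\<in>Units S. a = x \<otimes>\<^bsub>S\<^esub> b)"
  unfolding unit_class_def using assms
  by (subst eq_equiv_class_iff[OF equiv_unit_rel]) (auto simp: unit_rel_def)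

lemma carrier_quotient: "carrier (quotient_semigroup S) = unit_class S ` carrier S"
  by (auto simp: quotient_semigroup_def quotient_def unit_class_def)

lemma one_quotient: "\<one>\<^bsub>quotient_semigroup S\<^esub> = unit_class S \<one>\<^bsub>S\<^esub>"
  by (simp add: quotient_semigroup_def)

lemma cond_C1D:
  assumes "cond_C1 S" "a \<in> carrier S" "x \<in> Units S"
  shows "\<exists>y\<in>Units S. a \<otimes>\<^bsub>S\<^esub> x = y \<otimes>\<^bsub>S\<^esub> a"
  using assms unfolding cond_C1_def l_coset_def r_coset_def by blast

lemma cond_C1I:
  assumes "\<And>a x. a \<in> carrier S \<Longrightarrow> x \<in> Units S \<Longrightarrow> \<exists>y\<in>Units S. a \<otimes>\<^bsub>S\<^esub> x = y \<otimes>\<^bsub>S\<^esub> a"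
  shows "cond_C1 S"
  unfolding cond_C1_def l_coset_def r_coset_def using assms by blast

lemma monoid_quotient:
  assumes "monoid S" "cond_C1 S"
  shows "monoid (quotient_semigroup S)"
proof -
  interpret monoid S by fact
  show ?thesis
    by (rule monoidI)
      (auto simp: carrier_quotient one_quotient quotient_mult_class[OF assms] m_assoc)
qed

text \<open>A transversal homomorphism amounts to a multiplicative normal form \<open>s\<close> on
  elements, which selects one representative from each class. Working with \<open>s\<close> avoids
  handling classes in the constructions below.\<close>

lemma transversal_homI:
  assumes S: "monoid S" "cond_C1 S"
    and s: "\<And>a. a \<in> carrier S \<Longrightarrow> \<exists>x\<in>Units S. s a = x \<otimes>\<^bsub>S\<^esub> a"
    and const: "\<And>a x. a \<in> carrier S \<Longrightarrow> x \<in> Units S \<Longrightarrow> s (x \<otimes>\<^bsub>S\<^esub> a) = s a"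
    and mult: "\<And>a b. a \<in> carrier S \<Longrightarrow> b \<in> carrier S \<Longrightarrow> s (a \<otimes>\<^bsub>S\<^esub> b) = s a \<otimes>\<^bsub>S\<^esub> s b"
  shows "\<exists>\<phi>. transversal_hom S \<phi> \<and> (\<forall>a\<in>carrier S. \<phi> (unit_class S a) = s a)"
proof -
  interpret monoid S by fact
  \<comment> \<open>The choice of a member of \<open>X\<close> is immaterial, because
    \<open>const\<close> makes \<open>s\<close> constant on each class.\<close>
  define \<phi> where "\<phi> X = s (SOME a. a \<in> X)" for X
  have \<phi>: "\<phi> (unit_class S a) = s a" if a: "a \<in> carrier S" for a
  proof -
    define b where "b = (SOME b. b \<in> unit_class S a)"
    have "b \<in> unit_class S a"
      unfolding b_def using unit_class_self[OF S(1) a] by (rule someI)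
    then have "(a, b) \<in> unit_rel S"
      by (simp add: unit_class_def)
    then have "s a = s b"
      using const by (auto simp: unit_rel_def)
    then show ?thesis
      by (simp add: \<phi>_def b_def)
  qed
  have closed: "s a \<in> carrier S" if "a \<in> carrier S" for a
    using s[OF that] that by (auto simp: Units_closed)
  have "\<phi> \<in> hom (quotient_semigroup S) S"
    by (rule homI) (auto simp: carrier_quotient \<phi> closed mult quotient_mult_class[OF S])
  moreover have "\<forall>X\<in>carrier (quotient_semigroup S). unit_class S (\<phi> X) = X"
    using s closed by (auto simp: carrier_quotient \<phi> unit_class_eq_iff[OF S(1)])
  ultimately show ?thesis
    using \<phi> unfolding transversal_hom_def by blast
qed

text \<open>The quotient map is a left inverse of \<open>\<phi>\<close>.\<close>

lemma transversal_hom_inj: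
  "transversal_hom S \<phi> \<Longrightarrow> inj_on \<phi> (carrier (quotient_semigroup S))"
  unfolding transversal_hom_def by (metis inj_onI)

lemma split_semigroups_iff:
  "S \<in> split_semigroups \<longleftrightarrow> monoid_cancel S \<and> cond_C1 S \<and> (\<exists>\<phi>. transversal_hom S \<phi>)"
  unfolding split_semigroups_def using transversal_hom_inj by blast

section \<open>From a transversal homomorphism to a semidirect product\<close>

locale split_semigroup = monoid_cancel S for S :: "('a, 'b) monoid_scheme" (structure) +
  fixes \<phi> :: "'a set \<Rightarrow> 'a"
  assumes C1: "cond_C1 S" and trans: "transversal_hom S \<phi>"
begin

abbreviation Q where "Q \<equiv> quotient_semigroup S"

lemma monoid_Q: "monoid Q"
  using monoid_quotient[OF monoid_axioms C1] .

lemma \<phi>_hom: "\<phi> \<in> hom Q S"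
  and class_\<phi>: "X \<in> carrier Q \<Longrightarrow> unit_class S (\<phi> X) = X"
  using trans by (auto simp: transversal_hom_def)

lemma \<phi>_closed: "X \<in> carrier Q \<Longrightarrow> \<phi> X \<in> carrier S"
  using \<phi>_hom by (rule hom_in_carrier)

text \<open>Preservation of the identity is not part of \<open>hom\<close>. The image of the
  identity is idempotent, and in a cancellative semigroup this forces it to be
  \<open>\<one>\<close>.\<close>

lemma \<phi>_one: "\<phi> \<one>\<^bsub>Q\<^esub> = \<one>"
proof -
  interpret Q: monoid Q by (rule monoid_Q)
  have "\<phi> \<one>\<^bsub>Q\<^esub> \<otimes> \<phi> \<one>\<^bsub>Q\<^esub> = \<phi> \<one>\<^bsub>Q\<^esub> \<otimes> \<one>"
    using hom_mult[OF \<phi>_hom, of "\<one>\<^bsub>Q\<^esub>" "\<one>\<^bsub>Q\<^esub>"] by (simp add: \<phi>_closed)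
  then show ?thesis
    by (rule l_cancel) (simp_all add: \<phi>_closed)
qed

lemma conj_action:
  assumes "X \<in> carrier Q" "g \<in> Units S"
  shows "conj_action S \<phi> X g \<in> Units S" "\<phi> X \<otimes> g = conj_action S \<phi> X g \<otimes> \<phi> X"
proof -
  obtain h where h: "h \<in> Units S" "\<phi> X \<otimes> g = h \<otimes> \<phi> X"
    using cond_C1D[OF C1 \<phi>_closed] assms by blast
  have "\<exists>!h. h \<in> Units S \<and> \<phi> X \<otimes> g = h \<otimes> \<phi> X"
    using h r_cancel \<phi>_closed[OF assms(1)] by (intro ex1I[of _ h]) (auto simp: Units_closed)
  then have "conj_action S \<phi> X g \<in> Units S \<and> \<phi> X \<otimes> g = conj_action S \<phi> X g \<otimes> \<phi> X"
    unfolding conj_action_def by (rule theI')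
  then show "conj_action S \<phi> X g \<in> Units S" "\<phi> X \<otimes> g = conj_action S \<phi> X g \<otimes> \<phi> X"
    by auto
qed

text \<open>Working form of the uniqueness: each law of the action is obtained by exhibiting a unit
  that satisfies the defining equation.\<close>

lemma conj_action_eqI:
  assumes "X \<in> carrier Q" "g \<in> Units S" "h \<in> Units S" "\<phi> X \<otimes> g = h \<otimes> \<phi> X"
  shows "conj_action S \<phi> X g = h"
  using conj_action[OF assms(1,2)] assms r_cancel \<phi>_closed by (metis Units_closed)

text \<open>As \<open>\<phi>\<close> preserves products and the identity, it carries an invertible
  class \<open>X\<close> to a unit of \<open>S\<close>. Units are equivalent to
  \<open>\<one>\<close>, and \<open>X\<close> is the class of \<open>\<phi> X\<close>.\<close>

lemma Units_Q: "Units Q = {\<one>\<^bsub>Q\<^esub>}"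
proof -
  interpret Q: monoid Q by (rule monoid_Q)
  have "X = \<one>\<^bsub>Q\<^esub>" if X: "X \<in> Units Q" for X
  proof -
    obtain Y where Y: "X \<in> carrier Q" "Y \<in> carrier Q"
      "Y \<otimes>\<^bsub>Q\<^esub> X = \<one>\<^bsub>Q\<^esub>" "X \<otimes>\<^bsub>Q\<^esub> Y = \<one>\<^bsub>Q\<^esub>"
      using X by (auto simp: Units_def)
    then have "\<phi> Y \<otimes> \<phi> X = \<one>" "\<phi> X \<otimes> \<phi> Y = \<one>"
      using hom_mult[OF \<phi>_hom, symmetric] \<phi>_one by auto
    then have "\<phi> X \<in> Units S"
      using Y \<phi>_closed by (auto simp: Units_def)
    then have "unit_class S (\<phi> X) = unit_class S \<one>"
      by (subst unit_class_eq_iff[OF monoid_axioms])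
        (auto simp: Units_closed intro!: bexI[of _ "\<phi> X"])
    then show ?thesis
      using Y class_\<phi> one_quotient by metis
  qed
  then show ?thesis
    by auto
qed

lemma injective_system: "injective_system (units_of S) Q (conj_action S \<phi>)"
proof -
  interpret Q: monoid Q by (rule monoid_Q)
  note closed = Units_closed \<phi>_closed
  \<comment> \<open>The embedding \<open>\<phi>\<close> pulls cancellation back from
    \<open>S\<close>.\<close>
  have "monoid_cancel Q"
    by (rule monoid_cancel_inj_hom[OF monoid_Q monoid_cancel_axioms \<phi>_hom transversal_hom_inj[OF trans]])
  moreover have "conj_action S \<phi> X (g \<otimes> h) = conj_action S \<phi> X g \<otimes> conj_action S \<phi> X h"
    if X: "X \<in> carrier Q" and g: "g \<in> Units S" and h: "h \<in> Units S" for X g h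
  proof (rule conj_action_eqI)
    let ?g = "conj_action S \<phi> X g" and ?h = "conj_action S \<phi> X h"
    note g' = conj_action[OF X g] and h' = conj_action[OF X h]
    have "\<phi> X \<otimes> (g \<otimes> h) = (\<phi> X \<otimes> g) \<otimes> h"
      using X g h by (simp add: m_assoc closed)
    also have "\<dots> = ?g \<otimes> (\<phi> X \<otimes> h)"
      unfolding g'(2) using X g' h by (simp add: m_assoc closed)
    also have "\<dots> = ?g \<otimes> ?h \<otimes> \<phi> X"
      unfolding h'(2) using X g' h' by (simp add: m_assoc closed)
    finally show "\<phi> X \<otimes> (g \<otimes> h) = ?g \<otimes> ?h \<otimes> \<phi> X" .
  qed (use X g h conj_action in auto)
  moreover have "conj_action S \<phi> X (conj_action S \<phi> Y g) = conj_action S \<phi> (X \<otimes>\<^bsub>Q\<^esub> Y) g"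
    if X: "X \<in> carrier Q" and Y: "Y \<in> carrier Q" and g: "g \<in> Units S" for X Y g
  proof (rule conj_action_eqI[symmetric])
    let ?h = "conj_action S \<phi> Y g"
    let ?k = "conj_action S \<phi> X ?h"
    note h = conj_action[OF Y g]
    note k = conj_action[OF X h(1)]
    show "?k \<in> Units S"
      by (rule k)
    \<comment> \<open>The unit \<open>g\<close> passes first \<open>\<phi> Y\<close>, becoming
      \<open>?h\<close>, and then \<open>\<phi> X\<close>, becoming \<open>?k\<close>.\<close>
    have "\<phi> (X \<otimes>\<^bsub>Q\<^esub> Y) \<otimes> g = \<phi> X \<otimes> (\<phi> Y \<otimes> g)"
      using X Y g by (simp add: hom_mult[OF \<phi>_hom] m_assoc closed)
    also have "\<dots> = (\<phi> X \<otimes> ?h) \<otimes> \<phi> Y"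
      unfolding h(2) using X Y h by (simp add: m_assoc closed)
    also have "\<dots> = ?k \<otimes> \<phi> (X \<otimes>\<^bsub>Q\<^esub> Y)"
      unfolding k(2) using X Y k by (simp add: hom_mult[OF \<phi>_hom] m_assoc closed)
    finally show "\<phi> (X \<otimes>\<^bsub>Q\<^esub> Y) \<otimes> g = ?k \<otimes> \<phi> (X \<otimes>\<^bsub>Q\<^esub> Y)" .
  qed (use X Y g in auto)
  moreover have "conj_action S \<phi> \<one>\<^bsub>Q\<^esub> g = g" if "g \<in> Units S" for g
    using that by (intro conj_action_eqI) (auto simp: \<phi>_one closed)
  \<comment> \<open>If \<open>g\<close> and \<open>h\<close> have the same image, then
    \<open>\<phi> X \<otimes> g = \<phi> X \<otimes> h\<close>, and left cancellation
    applies.\<close>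
  moreover have "inj_on (conj_action S \<phi> X) (Units S)" if "X \<in> carrier Q" for X
    using that conj_action l_cancel by (metis inj_onI closed)
  ultimately show ?thesis
    using units_group Units_Q conj_action(1)
    by (auto simp: injective_system_def acts_by_endos_def hom_def units_of_carrier units_of_mult)
qed

lemma iso_associated_semidirect:
  "(\<lambda>(g, X). g \<otimes> \<phi> X) \<in> iso (associated_semidirect S \<phi>) S"
proof -
  let ?f = "\<lambda>(g, X). g \<otimes> \<phi> X"
  note closed = Units_closed \<phi>_closed
  have "?f \<in> hom (associated_semidirect S \<phi>) S"
  proof (rule homI)
    fix u v assume "u \<in> carrier (associated_semidirect S \<phi>)" "v \<in> carrier (associated_semidirect S \<phi>)"
    then obtain g X h Y where uv: "u = (g, X)" "v = (h, Y)"
      and gh: "g \<in> Units S" "h \<in> Units S" and XY: "X \<in> carrier Q" "Y \<in> carrier Q"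
      by (auto simp: associated_semidirect_def semidirect_def units_of_carrier)
    let ?h = "conj_action S \<phi> X h"
    note h = conj_action[OF XY(1) gh(2)]
    \<comment> \<open>The twisted unit \<open>?h\<close> is turned back into \<open>h\<close> by
      moving it right past \<open>\<phi> X\<close>.\<close>
    have "g \<otimes> ?h \<otimes> \<phi> (X \<otimes>\<^bsub>Q\<^esub> Y) = g \<otimes> (?h \<otimes> \<phi> X) \<otimes> \<phi> Y"
      using gh XY h(1) by (simp add: hom_mult[OF \<phi>_hom] m_assoc closed)
    also have "\<dots> = (g \<otimes> \<phi> X) \<otimes> (h \<otimes> \<phi> Y)"
      unfolding h(2)[symmetric] using gh XY by (simp add: m_assoc closed)
    finally show "?f (u \<otimes>\<^bsub>associated_semidirect S \<phi>\<^esub> v) = ?f u \<otimes> ?f v"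
      by (simp add: uv associated_semidirect_def semidirect_def units_of_mult)
  qed (auto simp: associated_semidirect_def semidirect_def units_of_carrier closed)
  moreover have "inj_on ?f (Units S \<times> carrier Q)"
  proof (rule inj_onI, clarify)
    fix g X h Y
    assume gh: "g \<in> Units S" "h \<in> Units S" and XY: "X \<in> carrier Q" "Y \<in> carrier Q"
      and eq: "g \<otimes> \<phi> X = h \<otimes> \<phi> Y"
    \<comment> \<open>The class of the product determines the second component; right cancellation
      by \<open>\<phi> X\<close> then determines the first.\<close>
    have class_eq: "unit_class S (k \<otimes> \<phi> Z) = Z" if "k \<in> Units S" "Z \<in> carrier Q" for k Z
    proof -
      have "unit_class S (k \<otimes> \<phi> Z) = unit_class S (\<phi> Z)"
        using that by (subst unit_class_eq_iff[OF monoid_axioms]) (auto simp: closed)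
      then show ?thesis
        using that class_\<phi> by simp
    qed
    have "X = Y"
      using class_eq[OF gh(1) XY(1)] class_eq[OF gh(2) XY(2)] eq by simp
    then show "g = h \<and> X = Y"
      using eq r_cancel gh XY by (auto simp: closed)
  qed
  moreover have "?f ` (Units S \<times> carrier Q) = carrier S"
  proof (intro equalityI subsetI)
    fix a assume a: "a \<in> carrier S"
    then have X: "unit_class S a \<in> carrier Q"
      by (simp add: carrier_quotient)
    \<comment> \<open>The elements \<open>a\<close> and \<open>\<phi> (unit_class S a)\<close> lie
      in the same class, so they differ by a unit \<open>x\<close> on the left, which is the first
      component of a preimage.\<close>
    then have "unit_class S a = unit_class S (\<phi> (unit_class S a))"
      using class_\<phi> by simp
    then obtain x where "x \<in> Units S" "a = x \<otimes> \<phi> (unit_class S a)"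
      using unit_class_eq_iff[OF monoid_axioms a \<phi>_closed[OF X]] by blast
    then show "a \<in> ?f ` (Units S \<times> carrier Q)"
      using X by (intro image_eqI[of _ _ "(x, unit_class S a)"]) auto
  qed (auto simp: closed)
  ultimately show ?thesis
    by (auto simp: iso_iff associated_semidirect_def semidirect_def units_of_carrier)
qed

end

text \<open>This places the recoded copy of a semidirect product in the class. All data are carried
  along \<open>f\<close> and its inverse \<open>k\<close>.\<close>

lemma split_semigroups_iso:
  assumes S: "S \<in> split_semigroups" and T: "monoid T" and "S \<cong> T"
  shows "T \<in> split_semigroups"
proof -
  obtain \<phi> where \<phi>: "monoid_cancel S" "cond_C1 S" "transversal_hom S \<phi>"
    using S by (auto simp: split_semigroups_iff)
  interpret S: split_semigroup S \<phi>
    using \<phi> by (intro split_semigroup.intro split_semigroup_axioms.intro)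
  interpret T: monoid T by fact
  obtain f where f: "f \<in> iso S T"
    using assms(3) by (auto simp: is_iso_def)
  define k where "k = inv_into (carrier S) f"
  have k: "k \<in> iso T S"
    unfolding k_def by (rule monoid_iso_set_sym) (rule S.monoid_axioms f)+
  have fk: "f (k b) = b" if "b \<in> carrier T" for b
    using that f unfolding k_def iso_iff by (metis f_inv_into_f)
  have hom: "f \<in> hom S T" "k \<in> hom T S"
    using f k by (auto simp: iso_iff)
  note closed = hom_in_carrier[OF hom(1)] hom_in_carrier[OF hom(2)] T.Units_closed S.Units_closed
  note mult = hom_mult[OF hom(1)] hom_mult[OF hom(2)]
  note fU = monoid_iso_Units[OF S.monoid_axioms T f]
  note kU = monoid_iso_Units[OF T S.monoid_axioms k]
  have C1: "cond_C1 T"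
  proof (rule cond_C1I)
    fix a x assume a: "a \<in> carrier T" "x \<in> Units T"
    then obtain y where y: "y \<in> Units S" "k a \<otimes>\<^bsub>S\<^esub> k x = y \<otimes>\<^bsub>S\<^esub> k a"
      using cond_C1D[OF \<phi>(2)] kU closed by meson
    have "f (k a) \<otimes>\<^bsub>T\<^esub> f (k x) = f y \<otimes>\<^bsub>T\<^esub> f (k a)"
      using y a by (simp add: mult(1)[symmetric] closed)
    then show "\<exists>y\<in>Units T. a \<otimes>\<^bsub>T\<^esub> x = y \<otimes>\<^bsub>T\<^esub> a"
      using y a fU by (auto simp: fk closed)
  qed
  \<comment> \<open>The normal form of \<open>S\<close>, sending \<open>a\<close> to
    \<open>\<phi> (unit_class S a)\<close>, conjugated by the isomorphism.\<close>
  define s where "s b = f (\<phi> (unit_class S (k b)))" for b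
  have class_eq: "unit_class S (k b) \<in> carrier (quotient_semigroup S)" if "b \<in> carrier T" for b
    using that by (simp add: carrier_quotient closed)
  have "\<exists>\<psi>. transversal_hom T \<psi> \<and> (\<forall>a\<in>carrier T. \<psi> (unit_class T a) = s a)"
  proof (rule transversal_homI[OF T C1])
    fix a assume a: "a \<in> carrier T"
    have "unit_class S (\<phi> (unit_class S (k a))) = unit_class S (k a)"
      using S.class_\<phi>[OF class_eq[OF a]] .
    then obtain x where "x \<in> Units S" "\<phi> (unit_class S (k a)) = x \<otimes>\<^bsub>S\<^esub> k a"
      using a S.\<phi>_closed[OF class_eq[OF a]] unit_class_eq_iff[OF S.monoid_axioms] by (auto simp: closed)
    then show "\<exists>x\<in>Units T. s a = x \<otimes>\<^bsub>T\<^esub> a"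
      using a fU by (auto simp: s_def mult closed fk)
  next
    fix a x assume a: "a \<in> carrier T" "x \<in> Units T"
    have "unit_class S (k (x \<otimes>\<^bsub>T\<^esub> a)) = unit_class S (k a)"
      using a kU by (subst unit_class_eq_iff[OF S.monoid_axioms]) (auto simp: closed mult)
    then show "s (x \<otimes>\<^bsub>T\<^esub> a) = s a"
      by (simp add: s_def)
  next
    fix a b assume "a \<in> carrier T" "b \<in> carrier T"
    then show "s (a \<otimes>\<^bsub>T\<^esub> b) = s a \<otimes>\<^bsub>T\<^esub> s b"
      by (simp add: s_def mult closed class_eq S.\<phi>_closed hom_mult[OF S.\<phi>_hom]
          quotient_mult_class[OF S.monoid_axioms \<phi>(2), symmetric])
  qed
  then show ?thesis
    using monoid_cancel_iso[OF \<phi>(1) T f] C1 by (auto simp: split_semigroups_iff)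
qed

section \<open>Semidirect products\<close>

lemma semidirect_simps:
  "carrier (semidirect G P \<theta>) = carrier G \<times> carrier P"
  "(g, p) \<otimes>\<^bsub>semidirect G P \<theta>\<^esub> (h, q) = (g \<otimes>\<^bsub>G\<^esub> \<theta> p h, p \<otimes>\<^bsub>P\<^esub> q)"
  "\<one>\<^bsub>semidirect G P \<theta>\<^esub> = (\<one>\<^bsub>G\<^esub>, \<one>\<^bsub>P\<^esub>)"
  by (simp_all add: semidirect_def)

locale inj_system = G: group G + P: monoid_cancel P
  for G :: "('g, 'c) monoid_scheme" and P :: "('p, 'd) monoid_scheme" and \<theta> +
  assumes Units_P: "Units P = {\<one>\<^bsub>P\<^esub>}"
    and acts: "acts_by_endos P G \<theta>"
    and inj: "p \<in> carrier P \<Longrightarrow> inj_on (\<theta> p) (carrier G)"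

lemma injective_system_iff: "injective_system G P \<theta> \<longleftrightarrow> inj_system G P \<theta>"
  by (auto simp: injective_system_def inj_system_def inj_system_axioms_def)

context inj_system
begin

abbreviation T where "T \<equiv> semidirect G P \<theta>"

lemma \<theta>_hom: "p \<in> carrier P \<Longrightarrow> \<theta> p \<in> hom G G"
  and \<theta>_\<theta>: "p \<in> carrier P \<Longrightarrow> q \<in> carrier P \<Longrightarrow> g \<in> carrier G \<Longrightarrow> \<theta> p (\<theta> q g) = \<theta> (p \<otimes>\<^bsub>P\<^esub> q) g"
  and \<theta>_id: "g \<in> carrier G \<Longrightarrow> \<theta> \<one>\<^bsub>P\<^esub> g = g"
  using acts by (auto simp: acts_by_endos_def)

lemma \<theta>_closed: "p \<in> carrier P \<Longrightarrow> g \<in> carrier G \<Longrightarrow> \<theta> p g \<in> carrier G"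
  using \<theta>_hom hom_in_carrier by metis

lemma \<theta>_mult:
  "p \<in> carrier P \<Longrightarrow> g \<in> carrier G \<Longrightarrow> h \<in> carrier G \<Longrightarrow> \<theta> p (g \<otimes>\<^bsub>G\<^esub> h) = \<theta> p g \<otimes>\<^bsub>G\<^esub> \<theta> p h"
  using \<theta>_hom hom_mult by metis

lemma \<theta>_one: "p \<in> carrier P \<Longrightarrow> \<theta> p \<one>\<^bsub>G\<^esub> = \<one>\<^bsub>G\<^esub>"
  using hom_one[OF \<theta>_hom] G.group_axioms by blast

lemmas \<theta>_simps = \<theta>_\<theta> \<theta>_id \<theta>_closed \<theta>_mult \<theta>_one

lemma monoid_T: "monoid T"
  by (rule monoidI) (auto simp: semidirect_simps \<theta>_simps G.m_assoc P.m_assoc)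

text \<open>On the left, cancelling in \<open>G\<close> leaves an equation between values of
  \<open>\<theta> r\<close>, which injectivity resolves. On the right, the second components must be
  compared first: once \<open>p = q\<close>, both sides carry the same twist and \<open>G\<close>
  cancels it.\<close>

lemma monoid_cancel_T: "monoid_cancel T"
proof (rule monoid.monoid_cancelI[OF monoid_T])
  fix a b c assume "a \<in> carrier T" "b \<in> carrier T" "c \<in> carrier T"
  then obtain g p h q k r where abc: "a = (g, p)" "b = (h, q)" "c = (k, r)"
    and G: "g \<in> carrier G" "h \<in> carrier G" "k \<in> carrier G"
    and P: "p \<in> carrier P" "q \<in> carrier P" "r \<in> carrier P"
    by (auto simp: semidirect_simps)
  {
    assume "c \<otimes>\<^bsub>T\<^esub> a = c \<otimes>\<^bsub>T\<^esub> b"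
    then have eq: "k \<otimes>\<^bsub>G\<^esub> \<theta> r g = k \<otimes>\<^bsub>G\<^esub> \<theta> r h" "r \<otimes>\<^bsub>P\<^esub> p = r \<otimes>\<^bsub>P\<^esub> q"
      by (auto simp: abc semidirect_simps)
    have "\<theta> r g = \<theta> r h"
      using eq(1) G P by (simp add: \<theta>_closed)
    then show "a = b"
      using inj[OF P(3)] G P.l_cancel[OF eq(2) P] by (auto simp: abc inj_on_def)
  next
    assume "a \<otimes>\<^bsub>T\<^esub> c = b \<otimes>\<^bsub>T\<^esub> c"
    then have eq: "g \<otimes>\<^bsub>G\<^esub> \<theta> p k = h \<otimes>\<^bsub>G\<^esub> \<theta> q k" "p \<otimes>\<^bsub>P\<^esub> r = q \<otimes>\<^bsub>P\<^esub> r"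
      by (auto simp: abc semidirect_simps)
    have "p = q"
      by (rule P.r_cancel[OF eq(2) P])
    then show "a = b"
      using eq(1) G P by (simp add: abc \<theta>_closed)
  }
qed

lemma Units_T: "Units T = carrier G \<times> {\<one>\<^bsub>P\<^esub>}"
proof (intro equalityI subsetI)
  fix u assume "u \<in> Units T"
  then obtain g p h q where u: "u = (g, p)" "g \<in> carrier G" "p \<in> carrier P" "q \<in> carrier P"
    "q \<otimes>\<^bsub>P\<^esub> p = \<one>\<^bsub>P\<^esub>" "p \<otimes>\<^bsub>P\<^esub> q = \<one>\<^bsub>P\<^esub>"
    by (auto simp: Units_def semidirect_simps)
  then have "p \<in> Units P"
    by (auto simp: Units_def)
  then show "u \<in> carrier G \<times> {\<one>\<^bsub>P\<^esub>}"
    using u Units_P by auto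
next
  fix u assume "u \<in> carrier G \<times> {\<one>\<^bsub>P\<^esub>}"
  then obtain g where "u = (g, \<one>\<^bsub>P\<^esub>)" "g \<in> carrier G"
    by auto
  then show "u \<in> Units T"
    using G.Units_eq by (auto simp: Units_def semidirect_simps \<theta>_id)
qed

lemma cond_C1_T: "cond_C1 T"
proof (rule cond_C1I)
  fix a x assume "a \<in> carrier T" "x \<in> Units T"
  then obtain g p h where "a = (g, p)" "x = (h, \<one>\<^bsub>P\<^esub>)" "g \<in> carrier G" "h \<in> carrier G" "p \<in> carrier P"
    by (auto simp: Units_T semidirect_simps)
  \<comment> \<open>Left multiplication of \<open>(g, p)\<close> by \<open>(y, \<one>)\<close> gives
    \<open>(y g, p)\<close>, while the product to be matched is \<open>(g \<theta> p h, p)\<close>;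
    solving for \<open>y\<close> in \<open>G\<close> gives the witness.\<close>
  then show "\<exists>y\<in>Units T. a \<otimes>\<^bsub>T\<^esub> x = y \<otimes>\<^bsub>T\<^esub> a"
    by (intro bexI[of _ "(g \<otimes>\<^bsub>G\<^esub> \<theta> p h \<otimes>\<^bsub>G\<^esub> inv\<^bsub>G\<^esub> g, \<one>\<^bsub>P\<^esub>)"])
      (auto simp: Units_T semidirect_simps \<theta>_id \<theta>_closed G.m_assoc)
qed

lemma unit_class_T_eq_iff:
  assumes "g \<in> carrier G" "h \<in> carrier G" "p \<in> carrier P" "q \<in> carrier P"
  shows "unit_class T (g, p) = unit_class T (h, q) \<longleftrightarrow> p = q"
proof -
  \<comment> \<open>Units translate the first component and fix the second; translations of a group
    are transitive.\<close>
  have "\<exists>k\<in>carrier G. g = k \<otimes>\<^bsub>G\<^esub> h"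
    using assms by (intro bexI[of _ "g \<otimes>\<^bsub>G\<^esub> inv\<^bsub>G\<^esub> h"]) (auto simp: G.m_assoc)
  then show ?thesis
    using assms
    by (subst unit_class_eq_iff[OF monoid_T]) (auto simp: Units_T semidirect_simps \<theta>_id)
qed

lemma transversal_hom_T:
  "\<exists>\<phi>. transversal_hom T \<phi> \<and> (\<forall>p\<in>carrier P. \<phi> (unit_class T (\<one>\<^bsub>G\<^esub>, p)) = (\<one>\<^bsub>G\<^esub>, p))"
proof -
  \<comment> \<open>The normal form of \<open>(g, p)\<close> is \<open>(\<one>, p)\<close>, reached
    by multiplying with the unit \<open>(inv g, \<one>)\<close> on the left.\<close>
  have "\<exists>\<phi>. transversal_hom T \<phi> \<and> (\<forall>a\<in>carrier T. \<phi> (unit_class T a) = (\<one>\<^bsub>G\<^esub>, snd a))"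
  proof (rule transversal_homI[OF monoid_T cond_C1_T])
    fix a assume "a \<in> carrier T"
    then obtain g p where "a = (g, p)" "g \<in> carrier G" "p \<in> carrier P"
      by (auto simp: semidirect_simps)
    then show "\<exists>x\<in>Units T. (\<one>\<^bsub>G\<^esub>, snd a) = x \<otimes>\<^bsub>T\<^esub> a"
      by (intro bexI[of _ "(inv\<^bsub>G\<^esub> g, \<one>\<^bsub>P\<^esub>)"]) (auto simp: Units_T semidirect_simps \<theta>_id)
  qed (auto simp: Units_T semidirect_simps \<theta>_simps)
  then show ?thesis
    by (force simp: semidirect_simps)
qed

lemma T_split: "T \<in> split_semigroups"
  using monoid_cancel_T cond_C1_T transversal_hom_T by (auto simp: split_semigroups_iff)

section \<open>Recovering the group, the semigroup and the action\<close>

lemma iso_units_T: "(\<lambda>g. (g, \<one>\<^bsub>P\<^esub>)) \<in> iso G (units_of T)"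
  by (auto simp: iso_iff hom_def inj_on_def units_of_carrier units_of_mult Units_T semidirect_simps \<theta>_id)

text \<open>The pairs \<open>(\<one>, p)\<close> multiply like \<open>P\<close> because each
  \<open>\<theta> p\<close> fixes the identity of \<open>G\<close>, and each class contains exactly
  one of them.\<close>

lemma iso_quotient_T: "(\<lambda>p. unit_class T (\<one>\<^bsub>G\<^esub>, p)) \<in> iso P (quotient_semigroup T)"
  unfolding iso_iff
proof (intro conjI)
  show "(\<lambda>p. unit_class T (\<one>\<^bsub>G\<^esub>, p)) \<in> hom P (quotient_semigroup T)"
    by (rule homI)
      (auto simp: carrier_quotient quotient_mult_class[OF monoid_T cond_C1_T] semidirect_simps \<theta>_one)
  show "(\<lambda>p. unit_class T (\<one>\<^bsub>G\<^esub>, p)) ` carrier P = carrier (quotient_semigroup T)"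
  proof (intro equalityI subsetI)
    fix X assume "X \<in> carrier (quotient_semigroup T)"
    then obtain g p where "X = unit_class T (g, p)" "g \<in> carrier G" "p \<in> carrier P"
      by (auto simp: carrier_quotient semidirect_simps)
    then show "X \<in> (\<lambda>p. unit_class T (\<one>\<^bsub>G\<^esub>, p)) ` carrier P"
      using unit_class_T_eq_iff by (intro image_eqI[of _ _ p]) auto
  qed (auto simp: carrier_quotient semidirect_simps)
  show "inj_on (\<lambda>p. unit_class T (\<one>\<^bsub>G\<^esub>, p)) (carrier P)"
    by (auto simp: inj_on_def unit_class_T_eq_iff)
qed

text \<open>Both \<open>(\<one>, p) (g, \<one>)\<close> and
  \<open>(\<theta> p g, \<one>) (\<one>, p)\<close> equal \<open>(\<theta> p g, p)\<close>.\<close>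

lemma conj_action_T:
  assumes "transversal_hom T \<phi>" "\<phi> (unit_class T (\<one>\<^bsub>G\<^esub>, p)) = (\<one>\<^bsub>G\<^esub>, p)"
    "p \<in> carrier P" "g \<in> carrier G"
  shows "conj_action T \<phi> (unit_class T (\<one>\<^bsub>G\<^esub>, p)) (g, \<one>\<^bsub>P\<^esub>) = (\<theta> p g, \<one>\<^bsub>P\<^esub>)"
proof -
  interpret T: split_semigroup T \<phi>
    using monoid_cancel_T cond_C1_T assms(1)
    by (intro split_semigroup.intro split_semigroup_axioms.intro)
  show ?thesis
    using assms(2-)
    by (intro T.conj_action_eqI) (auto simp: carrier_quotient Units_T semidirect_simps \<theta>_simps)
qed

text \<open>This allows the quotient, whose elements are sets, to be replaced by a copy on another
  type; the copy acts through the inverse \<open>k\<close> of \<open>f\<close>.\<close>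

lemma change_monoid:
  assumes "monoid P'" "f \<in> iso P P'"
  shows "\<exists>\<theta>'. injective_system G P' \<theta>' \<and> T \<cong> semidirect G P' \<theta>'"
proof -
  interpret P': monoid P' by fact
  define k where "k = inv_into (carrier P) f"
  have k: "k \<in> iso P' P"
    unfolding k_def by (rule monoid_iso_set_sym) (rule P.monoid_axioms assms)+
  then have khom: "k \<in> hom P' P"
    by (simp add: iso_iff)
  have kf: "k (f p) = p" if "p \<in> carrier P" for p
    using that assms(2) unfolding k_def iso_iff by (simp add: inv_into_f_f)
  have k_one: "k \<one>\<^bsub>P'\<^esub> = \<one>\<^bsub>P\<^esub>"
    by (rule monoid_iso_one[OF P'.monoid_axioms P.monoid_axioms k])
  note kc = hom_in_carrier[OF khom] hom_mult[OF khom]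
  let ?\<theta> = "\<lambda>p. \<theta> (k p)"
  have "Units P' = {\<one>\<^bsub>P'\<^esub>}"
  proof -
    have "p = \<one>\<^bsub>P'\<^esub>" if "p \<in> Units P'" for p
    proof -
      have "k p = k \<one>\<^bsub>P'\<^esub>"
        using monoid_iso_Units[OF P'.monoid_axioms P.monoid_axioms k that] Units_P k_one by simp
      then show ?thesis
        using k that by (auto simp: iso_iff inj_on_def P'.Units_closed)
    qed
    then show ?thesis
      by auto
  qed
  moreover have "acts_by_endos P' G ?\<theta>"
    by (simp add: acts_by_endos_def kc \<theta>_hom \<theta>_\<theta> \<theta>_id k_one)
  ultimately have "injective_system G P' ?\<theta>"
    using monoid_cancel_iso[OF P.monoid_cancel_axioms assms] inj G.group_axioms
    by (simp add: injective_system_def kc)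
  moreover have "map_prod id f \<in> iso T (semidirect G P' ?\<theta>)"
    using assms(2)
    by (auto simp: iso_iff hom_def semidirect_simps kf Pi_def map_prod_surj_on
        intro!: map_prod_inj_on)
  ultimately show ?thesis
    using is_isoI by blast
qed

end

section \<open>Isomorphism classes\<close>

lemma semidirect_products_split: "T \<in> semidirect_products \<Longrightarrow> T \<in> split_semigroups"
  by (auto simp: semidirect_products_def injective_system_iff intro: inj_system.T_split)

lemma split_semigroups_monoid: "S \<in> split_semigroups \<Longrightarrow> monoid S"
  by (auto simp: split_semigroups_iff monoid_cancel_def)

lemma equiv_iso_within:
  assumes "\<And>S. S \<in> C \<Longrightarrow> monoid S"
  shows "equiv C (iso_within C)"
proof (rule equivI)
  show "sym (iso_within C)"
    using assms by (auto simp: iso_within_def sym_def intro: monoid_iso_sym)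
  show "trans (iso_within C)"
    unfolding iso_within_def trans_def using iso_trans by fast
qed (auto simp: iso_within_def refl_on_def)

lemma associated_semidirect_iso:
  assumes "S \<in> split_semigroups" "transversal_hom S \<phi>"
  shows "associated_semidirect S \<phi> \<cong> S" "monoid (associated_semidirect S \<phi>)"
proof -
  interpret split_semigroup S \<phi>
    using assms by (intro split_semigroup.intro split_semigroup_axioms.intro)
      (auto simp: split_semigroups_iff)
  show "associated_semidirect S \<phi> \<cong> S"
    using iso_associated_semidirect by (rule is_isoI)
  show "monoid (associated_semidirect S \<phi>)"
    using inj_system.monoid_T injective_system
    by (auto simp: associated_semidirect_def injective_system_iff)
qed

lemma ex_semidirect_product_iso:
  fixes S :: "'u monoid"
  assumes "S \<in> split_semigroups"
  shows "\<exists>T \<in> (semidirect_products :: ('u \<times> 'u) monoid set). S \<cong> T"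
proof -
  obtain \<phi> where \<phi>: "transversal_hom S \<phi>"
    using assms by (auto simp: split_semigroups_iff)
  interpret split_semigroup S \<phi>
    using assms \<phi> by (intro split_semigroup.intro split_semigroup_axioms.intro)
      (auto simp: split_semigroups_iff)
  interpret inj_system "units_of S" Q "conj_action S \<phi>"
    using injective_system by (simp add: injective_system_iff)
  \<comment> \<open>The image of the quotient under \<open>\<phi>\<close> lives on the type of
    \<open>S\<close>. It keeps the identity of \<open>S\<close> by
    \<open>\<phi>_one\<close>.\<close>
  define P where "P = S\<lparr>carrier := \<phi> ` carrier Q\<rparr>"
  have "monoid (S\<lparr>carrier := \<phi> ` carrier Q, one := \<phi> \<one>\<^bsub>Q\<^esub>\<rparr>)"
    by (rule P.hom_imp_img_monoid[OF \<phi>_hom])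
  then have "monoid P"
    by (simp add: P_def \<phi>_one)
  moreover have "\<phi> \<in> iso Q P"
    using \<phi>_hom transversal_hom_inj[OF \<phi>] by (auto simp: iso_iff P_def hom_def)
  ultimately obtain \<theta>' where \<theta>': "injective_system (units_of S) P \<theta>'"
    "associated_semidirect S \<phi> \<cong> semidirect (units_of S) P \<theta>'"
    using change_monoid[of P \<phi>] by (auto simp: associated_semidirect_def)
  have "S \<cong> semidirect (units_of S) P \<theta>'"
    using associated_semidirect_iso[OF assms \<phi>] \<theta>'(2) monoid_iso_sym iso_trans by blast
  then show ?thesis
    using \<theta>'(1) by (auto simp: semidirect_products_def)
qed

lemma ex_split_semigroup_iso:
  fixes T :: "('u \<times> 'u) monoid"
  assumes "infinite (UNIV :: 'u set)" "T \<in> semidirect_products"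
  shows "\<exists>S \<in> (split_semigroups :: 'u monoid set). T \<cong> S"
proof -
  \<comment> \<open>An infinite set is equinumerous with its square.\<close>
  have "\<exists>e :: 'u \<times> 'u \<Rightarrow> 'u. bij_betw e (UNIV \<times> UNIV) UNIV"
    using card_of_Times_same_infinite[OF assms(1)] by (simp only: card_of_ordIso)
  then obtain e :: "'u \<times> 'u \<Rightarrow> 'u" where "inj e"
    by (auto simp: bij_betw_def)
  moreover have T: "T \<in> split_semigroups"
    using assms(2) by (rule semidirect_products_split)
  ultimately obtain S :: "'u monoid" where "monoid S" "T \<cong> S"
    using ex_monoid_copy[of T e] split_semigroups_monoid inj_on_subset by blast
  then show ?thesis
    using split_semigroups_iso[OF T] by blast
qed

text \<open>For any \<open>S'\<close> in the class and any transversal homomorphism, the associated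
  semidirect product is isomorphic to \<open>S'\<close>, hence to \<open>S\<close>, so the choices
  drop out.\<close>

lemma associated_class_eq:
  fixes S :: "'u monoid"
  assumes "S \<in> split_semigroups"
  shows "associated_class (iso_within split_semigroups `` {S}) = {T \<in> semidirect_products. S \<cong> T}"
proof (intro equalityI subsetI)
  fix T assume "T \<in> associated_class (iso_within split_semigroups `` {S})"
  then obtain S' :: "'u monoid" and \<phi> where T: "T \<in> semidirect_products" "S' \<in> split_semigroups" "S \<cong> S'"
    "transversal_hom S' \<phi>" "associated_semidirect S' \<phi> \<cong> T"
    by (auto simp: associated_class_def iso_within_def)
  have "S' \<cong> associated_semidirect S' \<phi>"
    using associated_semidirect_iso[OF T(2,4)] monoid_iso_sym by blast
  then show "T \<in> {T \<in> semidirect_products. S \<cong> T}"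
    using T(1) iso_trans[OF iso_trans[OF T(3)] T(5)] by blast
next
  fix T :: "('u \<times> 'u) monoid" assume T: "T \<in> {T \<in> semidirect_products. S \<cong> T}"
  obtain \<phi> where \<phi>: "transversal_hom S \<phi>"
    using assms by (auto simp: split_semigroups_iff)
  then have "associated_semidirect S \<phi> \<cong> T"
    using associated_semidirect_iso[OF assms] T iso_trans by blast
  then show "T \<in> associated_class (iso_within split_semigroups `` {S})"
    using assms \<phi> T by (auto simp: associated_class_def iso_within_def)
qed

lemma bij_betw_associated_class:
  assumes "infinite (UNIV :: 'u set)"
  shows "bij_betw associated_class
    ((split_semigroups :: 'u monoid set) // iso_within split_semigroups)
    ((semidirect_products :: ('u \<times> 'u) monoid set) // iso_within semidirect_products)"
proof -
  let ?C = "split_semigroups :: 'u monoid set"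
  let ?D = "semidirect_products :: ('u \<times> 'u) monoid set"
  have monD: "monoid T" if "T \<in> ?D" for T
    using that semidirect_products_split split_semigroups_monoid by blast
  have eqC: "equiv ?C (iso_within ?C)" and eqD: "equiv ?D (iso_within ?D)"
    by (auto intro: equiv_iso_within split_semigroups_monoid monD)
  \<comment> \<open>Bijectivity reduces to finding, for each member of one class of semigroups, an
    isomorphic member of the other.\<close>
  have class_eq: "associated_class (iso_within ?C `` {S}) = iso_within ?D `` {T}"
    if "S \<in> ?C" "T \<in> ?D" "S \<cong> T" for S T
  proof -
    have "T \<cong> S"
      using monoid_iso_sym[OF split_semigroups_monoid[OF that(1)] that(3)] .
    then have "S \<cong> T' \<longleftrightarrow> T \<cong> T'" for T' :: "('u \<times> 'u) monoid"
      using iso_trans[OF \<open>T \<cong> S\<close>, of T'] iso_trans[OF that(3), of T'] by blast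
    then show ?thesis
      unfolding associated_class_eq[OF that(1)] using that(2) by (simp add: iso_within_def Image_def)
  qed
  show ?thesis
    unfolding bij_betw_def
  proof (intro conjI equalityI subsetI)
    show "inj_on associated_class (?C // iso_within ?C)"
    proof (rule inj_onI)
      fix X Y assume XY: "X \<in> ?C // iso_within ?C" "Y \<in> ?C // iso_within ?C"
        and eq: "associated_class X = associated_class Y"
      then obtain S S' where S: "S \<in> ?C" "S' \<in> ?C"
        "X = iso_within ?C `` {S}" "Y = iso_within ?C `` {S'}"
        by (auto elim!: quotientE)
      \<comment> \<open>The existence of some \<open>T\<close> is what gives the equality of the two
        images content: \<open>T\<close> lies in both, which links \<open>S\<close> to
        \<open>S'\<close>.\<close>
      obtain T where T: "T \<in> ?D" "S \<cong> T"
        using ex_semidirect_product_iso[OF S(1)] by blast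
      then have "S' \<cong> T"
        using eq S by (auto simp: associated_class_eq)
      then have "S \<cong> S'"
        using T split_semigroups_monoid[OF S(2)] monoid_iso_sym iso_trans by blast
      then show "X = Y"
        using S equiv_class_eq[OF eqC] by (simp add: iso_within_def)
    qed
  next
    fix Y assume "Y \<in> associated_class ` (?C // iso_within ?C)"
    then obtain S where S: "S \<in> ?C" "Y = associated_class (iso_within ?C `` {S})"
      by (auto elim!: quotientE)
    then show "Y \<in> ?D // iso_within ?D"
      using ex_semidirect_product_iso[OF S(1)] class_eq by (auto intro: quotientI)
  next
    fix Y assume "Y \<in> ?D // iso_within ?D"
    then obtain T where T: "T \<in> ?D" "Y = iso_within ?D `` {T}"
      by (auto elim!: quotientE)
    \<comment> \<open>Infiniteness of the type enters here, to recode \<open>T\<close> on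
      \<open>'u\<close>.\<close>
    then obtain S where S: "S \<in> ?C" "T \<cong> S"
      using ex_split_semigroup_iso[OF assms] by blast
    then have "Y = associated_class (iso_within ?C `` {S})"
      using class_eq T monD monoid_iso_sym by blast
    then show "Y \<in> associated_class ` (?C // iso_within ?C)"
      using S by (auto intro: quotientI)
  qed
qed

text \<open>The first two conjuncts say that the constructions are mutually inverse up to
  isomorphism: one returns to \<open>S\<close>, the other recovers \<open>G\<close>,
  \<open>P\<close> and, for a suitable \<open>\<phi>\<close>, the action. The third expresses this
  on isomorphism classes over one fixed type.\<close>

theorem proposition2p11:
  shows
    "(\<forall>S \<in> (split_semigroups :: 'a monoid set). \<forall>\<phi>. transversal_hom S \<phi> \<longrightarrow>
        injective_system (units_of S) (quotient_semigroup S) (conj_action S \<phi>) \<and>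
        (\<lambda>(g, X). g \<otimes>\<^bsub>S\<^esub> \<phi> X) \<in> iso (associated_semidirect S \<phi>) S) \<and>
     (\<forall>(G :: 'g monoid) (P :: 'p monoid) \<theta> T.
        injective_system G P \<theta> \<longrightarrow> T = semidirect G P \<theta> \<longrightarrow>
          T \<in> split_semigroups \<and>
          (\<lambda>g. (g, \<one>\<^bsub>P\<^esub>)) \<in> iso G (units_of T) \<and>
          (\<lambda>p. unit_class T (\<one>\<^bsub>G\<^esub>, p)) \<in> iso P (quotient_semigroup T) \<and>
          (\<exists>\<phi>. transversal_hom T \<phi> \<and>
            (\<forall>p\<in>carrier P. \<phi> (unit_class T (\<one>\<^bsub>G\<^esub>, p)) = (\<one>\<^bsub>G\<^esub>, p)) \<and>
            (\<forall>p\<in>carrier P. \<forall>g\<in>carrier G.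
              conj_action T \<phi> (unit_class T (\<one>\<^bsub>G\<^esub>, p)) (g, \<one>\<^bsub>P\<^esub>) = (\<theta> p g, \<one>\<^bsub>P\<^esub>)))) \<and>
     (infinite (UNIV :: 'u set) \<longrightarrow>
        bij_betw associated_class
          ((split_semigroups :: 'u monoid set) // iso_within split_semigroups)
          ((semidirect_products :: ('u \<times> 'u) monoid set) // iso_within semidirect_products))"
proof (intro conjI ballI allI impI)
  fix S :: "'a monoid" and \<phi>
  assume "S \<in> split_semigroups" "transversal_hom S \<phi>"
  then interpret split_semigroup S \<phi>
    by (intro split_semigroup.intro split_semigroup_axioms.intro) (auto simp: split_semigroups_iff)
  show "injective_system (units_of S) (quotient_semigroup S) (conj_action S \<phi>)"
    by (rule injective_system)
  show "(\<lambda>(g, X). g \<otimes>\<^bsub>S\<^esub> \<phi> X) \<in> iso (associated_semidirect S \<phi>) S"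
    by (rule iso_associated_semidirect)
next
  fix G :: "'g monoid" and P :: "'p monoid" and \<theta> T
  assume "injective_system G P \<theta>" and T: "T = semidirect G P \<theta>"
  then interpret inj_system G P \<theta>
    by (simp add: injective_system_iff)
  show "T \<in> split_semigroups" "(\<lambda>g. (g, \<one>\<^bsub>P\<^esub>)) \<in> iso G (units_of T)"
    "(\<lambda>p. unit_class T (\<one>\<^bsub>G\<^esub>, p)) \<in> iso P (quotient_semigroup T)"
    unfolding T by (rule T_split iso_units_T iso_quotient_T)+
  show "\<exists>\<phi>. transversal_hom T \<phi> \<and>
      (\<forall>p\<in>carrier P. \<phi> (unit_class T (\<one>\<^bsub>G\<^esub>, p)) = (\<one>\<^bsub>G\<^esub>, p)) \<and>
      (\<forall>p\<in>carrier P. \<forall>g\<in>carrier G.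
        conj_action T \<phi> (unit_class T (\<one>\<^bsub>G\<^esub>, p)) (g, \<one>\<^bsub>P\<^esub>) = (\<theta> p g, \<one>\<^bsub>P\<^esub>))"
    unfolding T using transversal_hom_T conj_action_T by blast
qed (rule bij_betw_associated_class)

end
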